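(* Let $L>0$, $f\in\mathcal F_L(\mathbb R^n)$, $x_0\in\mathbb R^n$, and let $(x^{(k)})_{k\in\mathbb N}$ be the trajectory of the accelerated gradient method (defined in the context) with initial point $x_0$ and parameters $(A_k)_{k\in\mathbb N}$ satisfying the step-size condition stated there. For $k\ge1$ define $$p^{(k)}:=-P_k\,(x^{(k+1)}-x^{(k)}),\qquad P_k:=\frac{4A_kA_{k+1}}{(\delta^+A_k)\sum_{i=1}^kA_i\,\delta^+A_i}.$$ Then: (a) For all $k\ge1$, $p^{(k)}\in\operatorname{dom} f^*$. Suppose moreover that $\operatorname{dom} f^*$ has a minimum-norm point $p^\star$. Then: (b) For all $k\ge1$, $$\|p^{(k)}-p^\star\|^2\le B_kD_f(x_0,p^\star)=\mathcal O(k^{-2}),\qquad B_k:=8\left(\frac{A_k\sqrt{A_{k+1}}+\sum_{i=1}^k\sqrt{A_i}\,\delta^+A_{i-1}}{\sum_{i=1}^kA_i\,\delta^+A_i}\right)^2.$$ (c) If additionally $p^\star\ne0$, then for all $k\ge1$, $$\|p^{(k)}\|^2-\|p^\star\|^2\le C'_kD_f(x_0,p^\star)+\frac{C_k^2D_f(x_0,p^\star)^2}{\|p^\star\|^2}=\mathcal O(k^{-2}),$$ where $C_k:=\dfrac{4A_{k+1}}{\sum_{i=1}^kA_i\,\delta^+A_i}$ and $C'_k:=B_k+2C_k$. Here $\mathcal O(k^{-2})$ refers to the right-hand side bounds as $k\to\infty$.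
   Context: $\|\cdot\|$ and $\langle\cdot,\cdot\rangle$ are the Euclidean norm and inner product on $\mathbb R^n$. For $L>0$, $\mathcal F_L(\mathbb R^n)$ is the set of finite-valued differentiable convex functions $f:\mathbb R^n\to\mathbb R$ whose gradient is $L$-Lipschitz. The Legendre--Fenchel conjugate is $f^*(p):=\sup_{x\in\mathbb R^n}\{\langle p,x\rangle-f(x)\}\in\mathbb R\cup\{\infty\}$, and $\operatorname{dom} f^*:=\{p: f^*(p)<\infty\}$ (convex, nonempty, not necessarily closed). The dual divergence is $D_f(x,p):=f(x)+f^*(p)-\langle p,x\rangle$. Accelerated gradient method: let $(A_k)_{k\in\mathbb N}$ be real numbers with $\delta^+A_k:=A_{k+1}-A_k$ satisfying the step-size condition $$A_0=0,\qquad 0<\delta^+A_k\le 2\sqrt{A_{k+1}/L}\ \ (\forall k\in\mathbb N),\qquad \delta^+A_k=\Theta(k)\ (k\to\infty).$$ Set $x^{(0)}:=y^{(0)}:=x_0$ and, for $k\in\mathbb N$, $$x^{(k+1)}:=y^{(k)}-\frac{(\delta^+A_k)^2}{4A_{k+1}}\nabla f(y^{(k)}),\qquad y^{(k+1)}:=x^{(k+1)}+\frac{A_k\,\delta^+A_{k+1}}{A_{k+2}\,\delta^+A_k}\,(x^{(k+1)}-x^{(k)}).$$ *)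

theory Defs
  imports "HOL-Analysis.Analysis" "HOL-Library.Landau_Symbols"
begin

definition gradient :: "(real^'n \<Rightarrow> real) \<Rightarrow> real^'n \<Rightarrow> real^'n" where
  "gradient f x = (THE D. GDERIV f x :> D)"

definition smooth_convex :: "real \<Rightarrow> (real^'n \<Rightarrow> real) set" where
  "smooth_convex L =
     {f. convex_on UNIV f \<and> (\<forall>x. f differentiable (at x)) \<and> L-lipschitz_on UNIV (gradient f)}"

definition fenchel_conjugate :: "(real^'n \<Rightarrow> real) \<Rightarrow> real^'n \<Rightarrow> ereal" where
  "fenchel_conjugate f p = (SUP x. ereal (p \<bullet> x - f x))"

definition conjugate_dom :: "(real^'n \<Rightarrow> real) \<Rightarrow> (real^'n) set" where
  "conjugate_dom f = {p. fenchel_conjugate f p < \<infinity>}"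

text \<open>The conjugate of a real-valued function is never \<open>-\<infinity>\<close>, so the sum below is
  never of the form \<open>\<infinity> - \<infinity>\<close>.\<close>

definition dual_divergence :: "(real^'n \<Rightarrow> real) \<Rightarrow> real^'n \<Rightarrow> real^'n \<Rightarrow> ereal" where
  "dual_divergence f x p = ereal (f x) + fenchel_conjugate f p - ereal (p \<bullet> x)"

definition fwd_diff :: "(nat \<Rightarrow> real) \<Rightarrow> nat \<Rightarrow> real" where
  "fwd_diff A k = A (k + 1) - A k"

definition step_size_condition :: "real \<Rightarrow> (nat \<Rightarrow> real) \<Rightarrow> bool" where
  "step_size_condition L A \<longleftrightarrow>
     A 0 = 0 \<and>
     (\<forall>k. 0 < fwd_diff A k \<and> fwd_diff A k \<le> 2 * sqrt (A (k + 1) / L)) \<and>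
     fwd_diff A \<in> \<Theta>(\<lambda>k. real k)"

definition agm_trajectory ::
  "(real^'n \<Rightarrow> real) \<Rightarrow> (nat \<Rightarrow> real) \<Rightarrow> real^'n \<Rightarrow>
     (nat \<Rightarrow> real^'n) \<Rightarrow> (nat \<Rightarrow> real^'n) \<Rightarrow> bool" where
  "agm_trajectory f A x0 x y \<longleftrightarrow>
     x 0 = x0 \<and> y 0 = x0 \<and>
     (\<forall>k. x (k + 1) = y k - ((fwd_diff A k)\<^sup>2 / (4 * A (k + 1))) *\<^sub>R gradient f (y k)) \<and>
     (\<forall>k. y (k + 1) = x (k + 1) +
            ((A k * fwd_diff A (k + 1)) / (A (k + 2) * fwd_diff A k)) *\<^sub>R (x (k + 1) - x k))"

definition P_coeff :: "(nat \<Rightarrow> real) \<Rightarrow> nat \<Rightarrow> real" where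
  "P_coeff A k = 4 * A k * A (k + 1) / (fwd_diff A k * (\<Sum>i=1..k. A i * fwd_diff A i))"

definition dual_iterate :: "(nat \<Rightarrow> real) \<Rightarrow> (nat \<Rightarrow> real^'n) \<Rightarrow> nat \<Rightarrow> real^'n" where
  "dual_iterate A x k = - (P_coeff A k *\<^sub>R (x (k + 1) - x k))"

definition B_coeff :: "(nat \<Rightarrow> real) \<Rightarrow> nat \<Rightarrow> real" where
  "B_coeff A k =
     8 * ((A k * sqrt (A (k + 1)) + (\<Sum>i=1..k. sqrt (A i) * fwd_diff A (i - 1)))
            / (\<Sum>i=1..k. A i * fwd_diff A i))\<^sup>2"

definition C_coeff :: "(nat \<Rightarrow> real) \<Rightarrow> nat \<Rightarrow> real" where
  "C_coeff A k = 4 * A (k + 1) / (\<Sum>i=1..k. A i * fwd_diff A i)"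

definition C'_coeff :: "(nat \<Rightarrow> real) \<Rightarrow> nat \<Rightarrow> real" where
  "C'_coeff A k = B_coeff A k + 2 * C_coeff A k"

end

(* Put a_k = A_(k+1) - A_k and g_k = grad f(y_k).  With z_k = x_0 - (1/4) sum_(i<k) a_i g_i the method
   reads A_(k+1) y_k = A_k x_k + a_k z_k, A_(k+1) x_(k+1) = A_k x_k + a_k z_(k+1), and p_k is the average
   of the gradients g_i with weights A_i a_i (i <= k); this gives (a), because dom f* is convex.

   A minimum-norm point p of dom f* satisfies <p, grad f> >= |p|^2, hence |grad f| >= |p|, everywhere.
   Since cocoercivity makes a gradient step gain half of the squared gradient norm at both its endpoints,
   A_k f(x_k) + |p|^2/8 sum_(i<k) a_i^2 + 2 |x_0 - z_k|^2 <= A_k f(x_0).  The middle term is exactly what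
   is needed, through A_k^2 = sum_(i<k) a_i^2 + 2 sum_(i<k) A_i a_i, to recentre the estimate at p:
     |sum_(i<k) a_i (g_i - p)|^2 / 8 + <p, sum_(i<k) A_i a_i (g_i - p)> / 4 <= A_k D_f(x_0, p),
   with both terms on the left nonnegative.  The first one and summation by parts give (b), the
   second one gives <p, p_k - p> <= C_k D_f(x_0, p) and hence (c). *)

theory Submission
  imports Defs
begin

section \<open>Smooth convex functions\<close>

lemma GDERIV_unique:
  assumes "GDERIV f x :> D" "GDERIV f x :> E"
  shows "D = E"
proof -
  have "(\<lambda>h. h \<bullet> D) = (\<lambda>h. h \<bullet> E)"
    using assms unfolding gderiv_def by (rule has_derivative_unique)
  then have "h \<bullet> D = h \<bullet> E" for h
    by (rule fun_cong)
  then show ?thesis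
    using vector_eq_ldot by blast
qed

text \<open>The derivative is a linear functional, so \<open>adjoint f' 1\<close> represents it
  through the inner product; uniqueness identifies this vector with the one described in
  \<open>gradient\<close>.\<close>

lemma GDERIV_gradient:
  fixes f :: "real^'n \<Rightarrow> real"
  assumes "f differentiable (at x)"
  shows "GDERIV f x :> gradient f x"
proof -
  obtain f' where f': "(f has_derivative f') (at x)"
    using assms unfolding differentiable_def by blast
  then have lin: "linear f'"
    by (simp add: has_derivative_linear)
  have "f' = (\<lambda>h. h \<bullet> adjoint f' 1)"
    using adjoint_works[OF lin, of _ 1] by (auto simp: fun_eq_iff)
  then have G: "GDERIV f x :> adjoint f' 1"
    using f' unfolding gderiv_def by simp
  then show ?thesis
    unfolding gradient_def by (rule theI) (rule GDERIV_unique[OF _ G])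
qed

lemma DERIV_along_line:
  assumes "f \<in> smooth_convex L"
  shows "((\<lambda>t. f (x + t *\<^sub>R d)) has_field_derivative gradient f (x + t *\<^sub>R d) \<bullet> d) (at t within S)"
proof -
  have "(f has_derivative (\<lambda>h. h \<bullet> gradient f (x + t *\<^sub>R d))) (at (x + t *\<^sub>R d))"
    using GDERIV_gradient assms unfolding smooth_convex_def gderiv_def by blast
  moreover have "((\<lambda>t. x + t *\<^sub>R d) has_derivative (\<lambda>h. h *\<^sub>R d)) (at t within S)"
    by (auto intro!: derivative_eq_intros)
  ultimately have "((\<lambda>t. f (x + t *\<^sub>R d)) has_derivative
      (\<lambda>h. (h *\<^sub>R d) \<bullet> gradient f (x + t *\<^sub>R d))) (at t within S)"
    by (rule has_derivative_compose[rotated])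
  then show ?thesis
    unfolding has_field_derivative_def
    by (rule has_derivative_eq_rhs) (auto simp: fun_eq_iff inner_commute)
qed

section \<open>First-order inequalities for smooth convex functions\<close>

lemma gradient_inequality:
  assumes f: "f \<in> smooth_convex L"
  shows "f x + gradient f x \<bullet> (y - x) \<le> f y"
proof -
  \<comment> \<open>Restriction to the line through \<open>x\<close> and \<open>y\<close> reduces
    the claim to the tangent inequality in one variable.\<close>
  define \<phi> where "\<phi> = (\<lambda>t. f (x + t *\<^sub>R (y - x)))"
  have cf: "convex_on UNIV f"
    using f by (simp add: smooth_convex_def)
  have "convex_on UNIV \<phi>"
    unfolding convex_on_def
  proof (intro conjI ballI allI impI)
    fix s t u v :: real
    assume uv: "0 \<le> u" "0 \<le> v" "u + v = 1"
    have "x + (u *\<^sub>R s + v *\<^sub>R t) *\<^sub>R (y - x)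
        = u *\<^sub>R (x + s *\<^sub>R (y - x)) + v *\<^sub>R (x + t *\<^sub>R (y - x))"
      using uv(3) by (simp add: algebra_simps) (metis scaleR_add_left scaleR_one)
    then show "\<phi> (u *\<^sub>R s + v *\<^sub>R t) \<le> u * \<phi> s + v * \<phi> t"
      using cf uv unfolding convex_on_def \<phi>_def by auto
  qed auto
  then have "\<phi> 1 - \<phi> 0 \<ge> (gradient f (x + 0 *\<^sub>R (y - x)) \<bullet> (y - x)) * (1 - 0)"
    by (rule convex_on_imp_above_tangent) (auto simp only: \<phi>_def DERIV_along_line[OF f], auto)
  then show ?thesis
    by (simp add: \<phi>_def)
qed

lemma descent_lemma:
  assumes f: "f \<in> smooth_convex L"
  shows "f y \<le> f x + gradient f x \<bullet> (y - x) + L / 2 * (norm (y - x))\<^sup>2"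
proof -
  define d where "d = y - x"
  \<comment> \<open>Up to the constant \<open>f x\<close>, this is the gap between the two sides
    along the segment; the Lipschitz bound and Cauchy-Schwarz make its derivative
    nonnegative.\<close>
  define \<psi> where "\<psi> t = L / 2 * t\<^sup>2 * (norm d)\<^sup>2 + t * (gradient f x \<bullet> d) - f (x + t *\<^sub>R d)" for t
  have "\<psi> 0 \<le> \<psi> 1"
  proof (rule DERIV_nonneg_imp_nondecreasing[of 0 1 \<psi>])
    fix t :: real
    assume t: "0 \<le> t" "t \<le> 1"
    have "norm (gradient f (x + t *\<^sub>R d) - gradient f x) \<le> L * norm (t *\<^sub>R d)"
      using f lipschitz_onD[of L UNIV "gradient f" "x + t *\<^sub>R d" x]
      by (simp add: smooth_convex_def dist_norm)
    then have "norm (gradient f (x + t *\<^sub>R d) - gradient f x) * norm d \<le> L * t * norm d * norm d"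
      using t by (intro mult_right_mono) auto
    moreover have "(gradient f (x + t *\<^sub>R d) - gradient f x) \<bullet> d
        \<le> norm (gradient f (x + t *\<^sub>R d) - gradient f x) * norm d"
      by (rule norm_cauchy_schwarz)
    ultimately have "0 \<le> L * t * (norm d)\<^sup>2 + gradient f x \<bullet> d - gradient f (x + t *\<^sub>R d) \<bullet> d"
      by (simp add: inner_diff_left power2_eq_square)
    moreover have "(\<psi> has_field_derivative
        L * t * (norm d)\<^sup>2 + gradient f x \<bullet> d - gradient f (x + t *\<^sub>R d) \<bullet> d) (at t)"
      unfolding \<psi>_def by (auto intro!: derivative_eq_intros DERIV_along_line[OF f])
    ultimately show "\<exists>D. (\<psi> has_field_derivative D) (at t) \<and> 0 \<le> D"
      by blast
  qed simp
  then show ?thesis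
    by (simp add: \<psi>_def d_def)
qed

text \<open>Compare both sides at the point \<open>y - (\<nabla>f y - \<nabla>f x) / L\<close>.\<close>

lemma cocoercive_gradient_inequality:
  assumes f: "f \<in> smooth_convex L" and L: "L > 0"
  shows "f x + gradient f x \<bullet> (y - x) + 1 / (2 * L) * (norm (gradient f y - gradient f x))\<^sup>2 \<le> f y"
proof -
  define e where "e = gradient f y - gradient f x"
  define u where "u = y - (1 / L) *\<^sub>R e"
  have "f x + gradient f x \<bullet> (u - x) \<le> f u"
    by (rule gradient_inequality[OF f])
  also have "f u \<le> f y + gradient f y \<bullet> (u - y) + L / 2 * (norm (u - y))\<^sup>2"
    by (rule descent_lemma[OF f])
  also have "L / 2 * (norm (u - y))\<^sup>2 = 1 / (2 * L) * (e \<bullet> e)"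
    using L by (simp add: u_def power2_norm_eq_inner field_simps) (simp add: power2_eq_square)
  finally have "f x + gradient f x \<bullet> (y - x) - gradient f x \<bullet> ((1 / L) *\<^sub>R e)
      \<le> f y - gradient f y \<bullet> ((1 / L) *\<^sub>R e) + 1 / (2 * L) * (e \<bullet> e)"
    by (simp add: u_def inner_diff_right algebra_simps)
  moreover have "gradient f y \<bullet> ((1 / L) *\<^sub>R e) - gradient f x \<bullet> ((1 / L) *\<^sub>R e) = 2 * (1 / (2 * L) * (e \<bullet> e))"
    by (simp add: e_def inner_diff_left diff_divide_distrib)
  ultimately have "f x + gradient f x \<bullet> (y - x) + 1 / (2 * L) * (e \<bullet> e) \<le> f y"
    by linarith
  then show ?thesis
    by (simp add: e_def power2_norm_eq_inner)
qed

text \<open>Weaken the cocoercivity constant \<open>1 / (2 * L)\<close> to \<open>s / 2\<close> and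
  expand the square: since \<open>y - x\<close> is \<open>s\<close> times the gradient at
  \<open>y\<close>, the cross term cancels the linear term.\<close>

lemma gradient_step_decrease:
  assumes f: "f \<in> smooth_convex L" and L: "L > 0"
    and s: "0 \<le> s" "s \<le> 1 / L" and x: "x = y - s *\<^sub>R gradient f y"
  shows "f x \<le> f y - s / 2 * (norm (gradient f y))\<^sup>2 - s / 2 * (norm (gradient f x))\<^sup>2"
proof -
  define g where "g = gradient f y"
  define q where "q = gradient f x"
  have "s / 2 * (norm (g - q))\<^sup>2 \<le> 1 / (2 * L) * (norm (g - q))\<^sup>2"
    using s by (intro mult_right_mono) (auto simp: field_simps)
  moreover have "s / 2 * (norm (g - q))\<^sup>2 = s / 2 * (norm g)\<^sup>2 + s / 2 * (norm q)\<^sup>2 - q \<bullet> (y - x)"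
    by (simp add: x g_def power2_norm_eq_inner inner_diff_left inner_diff_right inner_commute algebra_simps)
  ultimately show ?thesis
    using cocoercive_gradient_inequality[OF f L, of x y] by (simp add: g_def q_def)
qed

section \<open>The domain of the conjugate\<close>

text \<open>Extracts a real conjugate value, so that later estimates stay in the reals. Minus
  infinity is excluded because the supremum dominates real numbers.\<close>

lemma conjugate_domE:
  assumes "p \<in> conjugate_dom f"
  obtains M where "fenchel_conjugate f p = ereal M" "\<And>x. p \<bullet> x - f x \<le> M"
proof -
  have fin: "fenchel_conjugate f p < \<infinity>"
    using assms by (simp add: conjugate_dom_def)
  have le: "ereal (p \<bullet> x - f x) \<le> fenchel_conjugate f p" for x
    unfolding fenchel_conjugate_def by (rule SUP_upper) simp
  show ?thesis
    using fin le that by (cases "fenchel_conjugate f p") auto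
qed

lemma conjugate_dom_iff: "p \<in> conjugate_dom f \<longleftrightarrow> (\<exists>M. \<forall>x. p \<bullet> x - f x \<le> M)"
proof
  assume "p \<in> conjugate_dom f"
  then show "\<exists>M. \<forall>x. p \<bullet> x - f x \<le> M"
    by (rule conjugate_domE) blast
next
  assume "\<exists>M. \<forall>x. p \<bullet> x - f x \<le> M"
  then obtain M where M: "\<And>x. p \<bullet> x - f x \<le> M" by blast
  have "fenchel_conjugate f p \<le> ereal M"
    unfolding fenchel_conjugate_def by (rule SUP_least) (simp add: M)
  then show "p \<in> conjugate_dom f"
    by (auto simp: conjugate_dom_def)
qed

lemma convex_conjugate_dom: "convex (conjugate_dom f)"
  unfolding convex_def
proof (intro ballI allI impI)
  fix p q and u v :: real
  assume uv: "0 \<le> u" "0 \<le> v" "u + v = 1"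
  assume "p \<in> conjugate_dom f" "q \<in> conjugate_dom f"
  then obtain M N where M: "\<And>x. p \<bullet> x - f x \<le> M" and N: "\<And>x. q \<bullet> x - f x \<le> N"
    unfolding conjugate_dom_iff by blast
  have "(u *\<^sub>R p + v *\<^sub>R q) \<bullet> x - f x \<le> u * M + v * N" for x
  proof -
    have "f x = (u + v) * f x"
      using uv by simp
    then have "(u *\<^sub>R p + v *\<^sub>R q) \<bullet> x - f x = u * (p \<bullet> x - f x) + v * (q \<bullet> x - f x)"
      by (simp add: inner_add_left algebra_simps)
    also have "\<dots> \<le> u * M + v * N"
      using uv M N by (intro add_mono mult_left_mono) auto
    finally show ?thesis .
  qed
  then show "u *\<^sub>R p + v *\<^sub>R q \<in> conjugate_dom f"
    unfolding conjugate_dom_iff by blast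
qed

text \<open>By the gradient inequality, \<open>y\<close> attains the supremum that defines the
  conjugate at \<open>gradient f y\<close>.\<close>

lemma gradient_in_conjugate_dom:
  assumes "f \<in> smooth_convex L"
  shows "gradient f y \<in> conjugate_dom f"
proof -
  have "gradient f y \<bullet> x - f x \<le> gradient f y \<bullet> y - f y" for x
    using gradient_inequality[OF assms, of y x] by (simp add: inner_diff_right)
  then show ?thesis
    unfolding conjugate_dom_iff by blast
qed

text \<open>The domain need not be closed, so the projection inequality is applied to a segment.\<close>

lemma min_norm_point_inner:
  fixes p q :: "'a::euclidean_space"
  assumes S: "convex S" and p: "is_arg_min norm (\<lambda>p. p \<in> S) p" and q: "q \<in> S"
  shows "p \<bullet> p \<le> p \<bullet> q"
proof -
  have "p \<in> S" and min: "\<And>r. r \<in> S \<Longrightarrow> norm p \<le> norm r"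
    using p by (auto simp: is_arg_min_def not_less)
  then have "closed_segment p q \<subseteq> S"
    using S q by (simp add: closed_segment_subset)
  then have "(0 - p) \<bullet> (q - p) \<le> 0"
    using min by (intro any_closest_point_dot[of "closed_segment p q"]) auto
  then show ?thesis
    by (simp add: inner_diff_right)
qed

section \<open>The accelerated gradient method\<close>

locale accelerated_gradient =
  fixes f :: "real^'n \<Rightarrow> real" and L :: real and A :: "nat \<Rightarrow> real"
    and x0 :: "real^'n" and x y :: "nat \<Rightarrow> real^'n"
  assumes L: "L > 0"
    and f: "f \<in> smooth_convex L"
    and steps: "step_size_condition L A"
    and traj: "agm_trajectory f A x0 x y"
begin

abbreviation a :: "nat \<Rightarrow> real" where "a \<equiv> fwd_diff A"

abbreviation g :: "nat \<Rightarrow> real^'n" where "g k \<equiv> gradient f (y k)"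

text \<open>The mirror-descent sequence hidden in the momentum form: it uses the same gradients as
  \<open>x\<close>, but with steps \<open>a k / 4\<close>.\<close>

definition z :: "nat \<Rightarrow> real^'n" where
  "z k = x0 - (1 / 4) *\<^sub>R (\<Sum>i<k. a i *\<^sub>R g i)"

lemma z_Suc: "z (Suc k) = z k - (a k / 4) *\<^sub>R g k"
  by (simp add: z_def algebra_simps)

lemma A_0: "A 0 = 0"
  and a_pos: "0 < a k"
  and a_le: "a k \<le> 2 * sqrt (A (Suc k) / L)"
  using steps by (auto simp: step_size_condition_def)

lemma A_Suc: "A (Suc k) = A k + a k"
  by (simp add: fwd_diff_def)

lemma A_nonneg: "0 \<le> A k"
  by (induction k) (use a_pos in \<open>auto simp: A_0 A_Suc intro: add_nonneg_nonneg less_imp_le\<close>)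

lemma A_Suc_pos: "0 < A (Suc k)"
  using A_nonneg[of k] a_pos[of k] by (simp add: A_Suc)

lemma A_pos: "0 < k \<Longrightarrow> 0 < A k"
  using A_Suc_pos[of "k - 1"] by simp

text \<open>Squaring the step-size condition makes \<open>gradient_step_decrease\<close> applicable
  to the update of \<open>x\<close>.\<close>

lemma step_le: "(a k)\<^sup>2 / (4 * A (Suc k)) \<le> 1 / L"
proof -
  have "(a k)\<^sup>2 \<le> (2 * sqrt (A (Suc k) / L))\<^sup>2"
    using a_le[of k] a_pos[of k] by (intro power_mono) auto
  also have "\<dots> = 4 * (A (Suc k) / L)"
    using A_nonneg[of "Suc k"] L by (simp add: power_mult_distrib)
  finally show ?thesis
    using A_Suc_pos[of k] L by (simp add: field_simps)
qed

lemma y_0: "y 0 = x0"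
  and x_Suc: "x (Suc k) = y k - ((a k)\<^sup>2 / (4 * A (Suc k))) *\<^sub>R g k"
  and y_Suc: "y (Suc k) = x (Suc k) +
        ((A k * a (Suc k)) / (A (Suc (Suc k)) * a k)) *\<^sub>R (x (Suc k) - x k)"
  using traj by (auto simp: agm_trajectory_def)

lemma x_step: "A (Suc k) *\<^sub>R x (Suc k) = A (Suc k) *\<^sub>R y k - ((a k)\<^sup>2 / 4) *\<^sub>R g k"
  using A_Suc_pos[of k] by (simp add: x_Suc scaleR_diff_right)

text \<open>The momentum coefficient is exactly the one that makes \<open>y\<close> an average of
  \<open>x\<close> and \<open>z\<close>. Only the claim for \<open>y\<close> needs
  induction.\<close>

lemma y_combination: "A (Suc k) *\<^sub>R y k = A k *\<^sub>R x k + a k *\<^sub>R z k"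
  and x_combination: "A (Suc k) *\<^sub>R x (Suc k) = A k *\<^sub>R x k + a k *\<^sub>R z (Suc k)"
proof -
  \<comment> \<open>The claim for \<open>x\<close> follows from that for \<open>y\<close> at the
    same index, since the gradient step in \<open>x_step\<close> is \<open>a k\<close> times the
    increment of \<open>z\<close>.\<close>
  have x: "A (Suc k) *\<^sub>R x (Suc k) = A k *\<^sub>R x k + a k *\<^sub>R z (Suc k)"
    if "A (Suc k) *\<^sub>R y k = A k *\<^sub>R x k + a k *\<^sub>R z k" for k
    using that by (simp add: x_step z_Suc scaleR_diff_right power2_eq_square)
  show y: "A (Suc k) *\<^sub>R y k = A k *\<^sub>R x k + a k *\<^sub>R z k" for k
  proof (induction k)
    case 0
    then show ?case by (simp add: y_0 z_def A_0 A_Suc)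
  next
    case (Suc k)
    \<comment> \<open>Solved for its direction, the \<open>x\<close> combination shows that
      \<open>z - x\<close> is parallel to the momentum term of \<open>y_Suc\<close>.\<close>
    have "a k *\<^sub>R (z (Suc k) - x (Suc k)) = A k *\<^sub>R (x (Suc k) - x k)"
      using x[OF Suc] by (simp add: A_Suc algebra_simps)
    then have "(1 / a k) *\<^sub>R (a k *\<^sub>R (z (Suc k) - x (Suc k))) = (1 / a k) *\<^sub>R (A k *\<^sub>R (x (Suc k) - x k))"
      by (rule arg_cong)
    then have z: "z (Suc k) - x (Suc k) = (A k / a k) *\<^sub>R (x (Suc k) - x k)"
      using a_pos[of k] by simp
    have "A (Suc (Suc k)) *\<^sub>R y (Suc k)
        = A (Suc (Suc k)) *\<^sub>R x (Suc k) + a (Suc k) *\<^sub>R ((A k / a k) *\<^sub>R (x (Suc k) - x k))"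
      using A_Suc_pos[of "Suc k"] a_pos[of k]
      by (simp add: y_Suc scaleR_add_right del: scaleR_diff_right)
    also have "\<dots> = A (Suc k) *\<^sub>R x (Suc k) + a (Suc k) *\<^sub>R z (Suc k)"
      unfolding z[symmetric] A_Suc[of "Suc k"] by (simp add: algebra_simps)
    finally show ?case .
  qed
  show "A (Suc k) *\<^sub>R x (Suc k) = A k *\<^sub>R x k + a k *\<^sub>R z (Suc k)"
    by (rule x[OF y])
qed

text \<open>By \<open>x_combination\<close> the left side at \<open>Suc k\<close> equals
  \<open>A k\<close> times \<open>x k - z (Suc k)\<close>, so moving \<open>z\<close> adds one
  weighted gradient. The weights \<open>A i * a i\<close> originate here.\<close>

lemma x_minus_z: "A k *\<^sub>R (x k - z k) = (1 / 4) *\<^sub>R (\<Sum>i<k. (A i * a i) *\<^sub>R g i)"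
proof (induction k)
  case 0
  then show ?case by (simp add: A_0)
next
  case (Suc k)
  have "A (Suc k) *\<^sub>R (x (Suc k) - z (Suc k)) = A k *\<^sub>R (x k - z k) + (A k * a k / 4) *\<^sub>R g k"
    by (simp add: scaleR_diff_right x_combination) (simp add: A_Suc z_Suc algebra_simps add_divide_distrib)
  then show ?case
    by (simp add: Suc scaleR_add_right)
qed

section \<open>Dual iterates as weighted averages of gradients\<close>

definition S :: "nat \<Rightarrow> real" where
  "S k = (\<Sum>i<k. A i * a i)"

text \<open>The index \<open>0\<close> carries weight zero because \<open>A 0 = 0\<close>; this
  matches the common denominator of the coefficients with sums over
  \<open>{..<Suc k}\<close>.\<close>

lemma sum_from_1: "(\<Sum>i=1..k. A i * a i) = S (Suc k)"
proof -
  have "{..<Suc k} = insert 0 {1..k}" by auto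
  then show ?thesis by (simp add: S_def A_0)
qed

lemma S_pos: "k \<ge> 1 \<Longrightarrow> 0 < S (Suc k)"
  unfolding sum_from_1[symmetric] by (rule sum_pos) (auto simp: A_pos a_pos)

text \<open>By \<open>x_combination\<close>, \<open>x k - x (Suc k)\<close> is a multiple of
  \<open>x (Suc k) - z (Suc k)\<close>, which \<open>x_minus_z\<close> turns into a gradient sum;
  \<open>P_coeff\<close> normalises the weights.\<close>

lemma dual_iterate_eq:
  assumes k: "k \<ge> 1"
  shows "dual_iterate A x k = (1 / S (Suc k)) *\<^sub>R (\<Sum>i<Suc k. (A i * a i) *\<^sub>R g i)"
proof -
  have "a k *\<^sub>R (x (Suc k) - z (Suc k)) = A k *\<^sub>R (x k - x (Suc k))"
    using x_combination[of k] by (simp add: A_Suc algebra_simps)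
  then have "(A (Suc k) / a k) *\<^sub>R (a k *\<^sub>R (x (Suc k) - z (Suc k)))
      = (A (Suc k) / a k) *\<^sub>R (A k *\<^sub>R (x k - x (Suc k)))"
    by (rule arg_cong)
  then have "A (Suc k) *\<^sub>R (x (Suc k) - z (Suc k)) = (A k * A (Suc k) / a k) *\<^sub>R (x k - x (Suc k))"
    using a_pos[of k] by (simp add: mult.commute)
  then have "(1 / 4) *\<^sub>R (\<Sum>i<Suc k. (A i * a i) *\<^sub>R g i) = (A k * A (Suc k) / a k) *\<^sub>R (x k - x (Suc k))"
    by (simp only: x_minus_z)
  then have "(4 / S (Suc k)) *\<^sub>R ((1 / 4) *\<^sub>R (\<Sum>i<Suc k. (A i * a i) *\<^sub>R g i))
     = (4 / S (Suc k)) *\<^sub>R ((A k * A (Suc k) / a k) *\<^sub>R (x k - x (Suc k)))"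
    by (rule arg_cong)
  then have "(1 / S (Suc k)) *\<^sub>R (\<Sum>i<Suc k. (A i * a i) *\<^sub>R g i)
     = P_coeff A k *\<^sub>R (x k - x (Suc k))"
    unfolding P_coeff_def sum_from_1 Suc_eq_plus1[symmetric]
    by (simp add: mult.commute mult.left_commute del: sum.lessThan_Suc)
  then show ?thesis
    by (simp add: dual_iterate_def scaleR_diff_right)
qed

lemma dual_iterate_minus:
  assumes "k \<ge> 1"
  shows "dual_iterate A x k - p = (1 / S (Suc k)) *\<^sub>R (\<Sum>i<Suc k. (A i * a i) *\<^sub>R (g i - p))"
proof -
  have "(\<Sum>i<Suc k. (A i * a i) *\<^sub>R (g i - p)) = (\<Sum>i<Suc k. (A i * a i) *\<^sub>R g i) - S (Suc k) *\<^sub>R p"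
    by (simp only: scaleR_diff_right sum_subtractf S_def scaleR_sum_left)
  then show ?thesis
    using S_pos[OF assms] by (simp only: dual_iterate_eq[OF assms] scaleR_diff_right) simp
qed

lemma dual_iterate_in_conjugate_dom:
  assumes k: "k \<ge> 1"
  shows "dual_iterate A x k \<in> conjugate_dom f"
proof -
  have "(\<Sum>i<Suc k. (A i * a i / S (Suc k)) *\<^sub>R g i) \<in> conjugate_dom f"
  proof (rule convex_sum)
    show "(\<Sum>i<Suc k. A i * a i / S (Suc k)) = 1"
      using S_pos[OF k] unfolding sum_divide_distrib[symmetric] S_def[symmetric] by simp
    show "0 \<le> A i * a i / S (Suc k)" for i
      using S_pos[OF k] A_nonneg[of i] a_pos[of i] by simp
  qed (auto intro: convex_conjugate_dom gradient_in_conjugate_dom f)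
  then show ?thesis
    by (simp only: dual_iterate_eq[OF k] scaleR_sum_right) (simp add: field_simps)
qed

section \<open>Energy estimates\<close>

text \<open>A lower bound \<open>e\<close> on the squared gradient norms enters the potential because
  the gradient step gains a term in the gradient at the \<^emph>\<open>new\<close> point.\<close>

lemma potential_le:
  assumes e: "\<And>u. e \<le> (norm (gradient f u))\<^sup>2"
  shows "A k * f (x k) + e / 8 * (\<Sum>i<k. (a i)\<^sup>2) + 2 * (norm (x0 - z k))\<^sup>2 \<le> A k * f x0"
proof (induction k)
  case 0
  then show ?case by (simp add: A_0 z_def)
next
  case (Suc k)
  define s where "s = (a k)\<^sup>2 / (4 * A (Suc k))"
  have s0: "0 \<le> s"
    using A_nonneg[of "Suc k"] by (simp add: s_def)
  \<comment> \<open>Source of the factor \<open>1 / 8\<close>: scaling by \<open>A (Suc k)\<close>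
    cancels the denominator of the step length.\<close>
  have As: "A (Suc k) * (s / 2) = (a k)\<^sup>2 / 8"
    using A_Suc_pos[of k] by (simp add: s_def)
  have "f (x (Suc k)) \<le> f (y k) - s / 2 * (norm (g k))\<^sup>2 - s / 2 * (norm (gradient f (x (Suc k))))\<^sup>2"
    using step_le[of k] s0 x_Suc[of k] by (intro gradient_step_decrease[OF f L]) (auto simp: s_def)
  also have "\<dots> \<le> f (y k) - s / 2 * (norm (g k))\<^sup>2 - s / 2 * e"
    using s0 e by (intro diff_left_mono mult_left_mono) auto
  finally have "A (Suc k) * f (x (Suc k)) \<le> A (Suc k) * (f (y k) - s / 2 * (norm (g k))\<^sup>2 - s / 2 * e)"
    using A_nonneg by (rule mult_left_mono)
  also have "\<dots> = A (Suc k) * f (y k) - (a k)\<^sup>2 / 8 * (norm (g k))\<^sup>2 - (a k)\<^sup>2 / 8 * e"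
    unfolding As[symmetric] by (simp add: algebra_simps)
  finally have 1: "A (Suc k) * f (x (Suc k))
      \<le> A (Suc k) * f (y k) - (a k)\<^sup>2 / 8 * (norm (g k))\<^sup>2 - (a k)\<^sup>2 / 8 * e" .
  \<comment> \<open>The gradient inequality at \<open>y k\<close> is tested at \<open>x k\<close>
    and at \<open>x0\<close>, with weights \<open>A k\<close> and \<open>a k\<close>;
    \<open>y_combination\<close> merges the linear terms into one along
    \<open>x0 - z k\<close>.\<close>
  have "A k * (f (y k) + g k \<bullet> (x k - y k)) \<le> A k * f (x k)"
    using A_nonneg gradient_inequality[OF f] by (rule mult_left_mono[rotated])
  moreover have "a k * (f (y k) + g k \<bullet> (x0 - y k)) \<le> a k * f x0"
    using a_pos[of k] gradient_inequality[OF f] by (intro mult_left_mono) auto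
  moreover have "A k * (f (y k) + g k \<bullet> (x k - y k)) + a k * (f (y k) + g k \<bullet> (x0 - y k))
      = A (Suc k) * f (y k) + g k \<bullet> (A k *\<^sub>R x k + a k *\<^sub>R x0 - A (Suc k) *\<^sub>R y k)"
    by (simp add: A_Suc inner_diff_right inner_add_right algebra_simps)
  moreover have "A k *\<^sub>R x k + a k *\<^sub>R x0 - A (Suc k) *\<^sub>R y k = a k *\<^sub>R (x0 - z k)"
    by (simp add: y_combination scaleR_diff_right)
  ultimately have 2: "A (Suc k) * f (y k) + a k * (g k \<bullet> (x0 - z k)) \<le> A k * f (x k) + a k * f x0"
    by simp
  \<comment> \<open>The factor \<open>2\<close> makes the cross term match the linear term of fact
    \<open>2\<close> and the last square match the gradient gain of fact \<open>1\<close>.\<close>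
  have "x0 - z (Suc k) = (x0 - z k) + (a k / 4) *\<^sub>R g k"
    by (simp add: z_Suc)
  then have 3: "2 * (norm (x0 - z (Suc k)))\<^sup>2
      = 2 * (norm (x0 - z k))\<^sup>2 + a k * (g k \<bullet> (x0 - z k)) + (a k)\<^sup>2 / 8 * (norm (g k))\<^sup>2"
    unfolding power2_norm_eq_inner
    by (simp only: inner_add_left inner_add_right inner_scaleR_left inner_scaleR_right)
      (simp add: inner_commute power2_eq_square algebra_simps)
  have "A (Suc k) * f x0 = A k * f x0 + a k * f x0"
    by (simp add: A_Suc algebra_simps)
  then show ?case
    using 1 2 3 Suc by (simp add: algebra_simps)
qed

text \<open>Telescopes the square of \<open>A k + a k\<close>. Multiplied by
  \<open>p \<bullet> p\<close>, the first sum is paid for by \<open>potential_le\<close> and the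
  second recentres the weighted gradients at \<open>p\<close>.\<close>

lemma A_square: "(A k)\<^sup>2 = (\<Sum>i<k. (a i)\<^sup>2) + 2 * S k"
  by (induction k) (auto simp: A_0 S_def A_Suc power2_eq_square algebra_simps)

text \<open>Use \<open>potential_le\<close> with \<open>e = p \<bullet> p\<close>, bound
  \<open>f (x k)\<close> below by \<open>p \<bullet> x k - M\<close>, and convert the remaining
  \<open>p \<bullet> (x k - z k)\<close> by \<open>x_minus_z\<close>.\<close>

lemma dual_potential_le:
  assumes p: "\<And>u. p \<bullet> p \<le> p \<bullet> gradient f u" and M: "\<And>u. p \<bullet> u - f u \<le> M"
  shows "(norm (\<Sum>i<k. a i *\<^sub>R (g i - p)))\<^sup>2 / 8
    \<le> A k * (f x0 + M - p \<bullet> x0) - p \<bullet> (\<Sum>i<k. (A i * a i) *\<^sub>R (g i - p)) / 4"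
proof -
  have "p \<bullet> p \<le> (norm (gradient f u))\<^sup>2" for u
  proof -
    have "0 \<le> (norm (gradient f u - p))\<^sup>2"
      by simp
    also have "\<dots> = (norm (gradient f u))\<^sup>2 + p \<bullet> p - 2 * (p \<bullet> gradient f u)"
      by (simp add: power2_norm_eq_inner inner_diff_left inner_diff_right inner_commute)
    finally show ?thesis
      using p[of u] by linarith
  qed
  then have pot: "A k * f (x k) + p \<bullet> p / 8 * (\<Sum>i<k. (a i)\<^sup>2) + 2 * (norm (x0 - z k))\<^sup>2 \<le> A k * f x0"
    by (rule potential_le)
  have "A k = (\<Sum>i<k. a i)"
    by (induction k) (auto simp: A_0 A_Suc)
  then have G: "(\<Sum>i<k. a i *\<^sub>R (g i - p)) = 4 *\<^sub>R (x0 - z k) - A k *\<^sub>R p"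
    by (simp add: z_def scaleR_diff_right sum_subtractf scaleR_sum_left)
  \<comment> \<open>Naming these products leaves only linear relations for the final
    combination.\<close>
  define U where "U = p \<bullet> p * (\<Sum>i<k. (a i)\<^sup>2)"
  define V where "V = p \<bullet> p * S k"
  have "p \<bullet> p * (A k)\<^sup>2 = U + 2 * V"
    by (simp add: U_def V_def A_square distrib_left)
  moreover have "(norm (\<Sum>i<k. a i *\<^sub>R (g i - p)))\<^sup>2 / 8
      = 2 * (norm (x0 - z k))\<^sup>2 - A k * (p \<bullet> (x0 - z k)) + p \<bullet> p * (A k)\<^sup>2 / 8"
    unfolding G power2_norm_eq_inner
    by (simp only: inner_diff_left inner_diff_right inner_scaleR_left inner_scaleR_right)
      (simp add: inner_commute power2_eq_square field_simps)
  moreover have "A k * (p \<bullet> (x0 - z k)) = A k * (p \<bullet> x0) - A k * (p \<bullet> z k)"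
    by (simp add: inner_diff_right right_diff_distrib)
  moreover have "A k * (p \<bullet> x k) - A k * M \<le> A k * f (x k)"
    using mult_left_mono[OF M[of "x k"] A_nonneg[of k]] by (simp add: right_diff_distrib)
  moreover have "A k * (p \<bullet> x k) - A k * (p \<bullet> z k) = p \<bullet> (\<Sum>i<k. (A i * a i) *\<^sub>R g i) / 4"
    using arg_cong[OF x_minus_z[of k], of "inner p"] by (simp add: inner_diff_right right_diff_distrib)
  moreover have "p \<bullet> (\<Sum>i<k. (A i * a i) *\<^sub>R (g i - p)) = p \<bullet> (\<Sum>i<k. (A i * a i) *\<^sub>R g i) - V"
    by (simp add: scaleR_diff_right sum_subtractf scaleR_sum_left[symmetric] inner_diff_right
        S_def V_def mult.commute)
  moreover have "A k * f (x k) + U / 8 + 2 * (norm (x0 - z k))\<^sup>2 \<le> A k * f x0"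
    using pot by (simp add: U_def)
  moreover have "A k * (f x0 + M - p \<bullet> x0) = A k * f x0 + A k * M - A k * (p \<bullet> x0)"
    by (simp add: right_diff_distrib distrib_left)
  ultimately show ?thesis
    by linarith
qed

text \<open>Abel summation with \<open>A i - A (i - 1) = a (i - 1)\<close>, which explains the
  shifted index in \<open>B_coeff\<close>. The partial sums on the right are those bounded by
  \<open>dual_potential_le\<close>.\<close>

lemma summation_by_parts:
  fixes h :: "nat \<Rightarrow> real^'n"
  shows "(\<Sum>i<Suc k. (A i * a i) *\<^sub>R h i)
    = A k *\<^sub>R (\<Sum>i<Suc k. a i *\<^sub>R h i) - (\<Sum>i=1..k. a (i - 1) *\<^sub>R (\<Sum>j<i. a j *\<^sub>R h j))"
proof (induction k)
  case 0
  then show ?case by (simp add: A_0)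
next
  case (Suc k)
  have "(\<Sum>i=1..Suc k. a (i - 1) *\<^sub>R (\<Sum>j<i. a j *\<^sub>R h j))
     = (\<Sum>i=1..k. a (i - 1) *\<^sub>R (\<Sum>j<i. a j *\<^sub>R h j)) + a k *\<^sub>R (\<Sum>j<Suc k. a j *\<^sub>R h j)"
    by simp
  then show ?case
    unfolding sum.lessThan_Suc[of _ "Suc k"] Suc
    by (simp add: A_Suc scaleR_add_left scaleR_add_right del: sum.lessThan_Suc sum.cl_ivl_Suc)
qed

text \<open>The square and the pairing with \<open>p\<close> in \<open>dual_potential_le\<close> are
  both nonnegative; discarding either one bounds the other, giving the two claims.\<close>

lemma dual_bounds:
  assumes p: "\<And>u. p \<bullet> p \<le> p \<bullet> gradient f u" and M: "\<And>u. p \<bullet> u - f u \<le> M"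
    and D: "D = f x0 + M - p \<bullet> x0" and k: "k \<ge> 1"
  shows "(norm (dual_iterate A x k - p))\<^sup>2 \<le> B_coeff A k * D"
    and "p \<bullet> (dual_iterate A x k - p) \<le> C_coeff A k * D"
proof -
  define G where "G j = (\<Sum>i<j. a i *\<^sub>R (g i - p))" for j
  define W where "W j = (\<Sum>i<j. (A i * a i) *\<^sub>R (g i - p))" for j
  have D0: "0 \<le> D"
    using M[of x0] D by simp
  have pot: "(norm (G j))\<^sup>2 / 8 \<le> A j * D - p \<bullet> W j / 4" for j
    using dual_potential_le[OF p M] by (simp add: G_def W_def D)
  have W0: "0 \<le> p \<bullet> W j" for j
    unfolding W_def inner_sum_right inner_scaleR_right
    using p A_nonneg a_pos by (intro sum_nonneg mult_nonneg_nonneg) (auto simp: inner_diff_right less_imp_le)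
  have "(norm (G j))\<^sup>2 \<le> 8 * (A j * D)" for j
    using pot[of j] W0[of j] by linarith
  then have "(norm (G j))\<^sup>2 \<le> 8 * D * A j" for j
    by (simp add: ac_simps)
  then have G: "norm (G j) \<le> sqrt (8 * D) * sqrt (A j)" for j
    unfolding real_sqrt_mult[symmetric] by (rule real_le_rsqrt)
  define N where "N = A k * sqrt (A (Suc k)) + (\<Sum>i=1..k. sqrt (A i) * a (i - 1))"
  \<comment> \<open>Abel summation transfers the bounds on the partial sums \<open>G\<close> to the
    weighted sum \<open>W\<close>.\<close>
  have "norm (W (Suc k)) \<le> norm (A k *\<^sub>R G (Suc k)) + norm (\<Sum>i=1..k. a (i - 1) *\<^sub>R G i)"
    unfolding W_def G_def summation_by_parts by (rule norm_triangle_ineq4)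
  also have "\<dots> \<le> A k * norm (G (Suc k)) + (\<Sum>i=1..k. a (i - 1) * norm (G i))"
    using A_nonneg[of k] a_pos by (intro add_mono sum_norm_le) (auto simp: less_imp_le)
  also have "\<dots> \<le> A k * (sqrt (8 * D) * sqrt (A (Suc k)))
      + (\<Sum>i=1..k. a (i - 1) * (sqrt (8 * D) * sqrt (A i)))"
    using A_nonneg a_pos G by (intro add_mono sum_mono mult_left_mono) (auto simp: less_imp_le)
  also have "\<dots> = sqrt (8 * D) * N"
    by (simp add: N_def distrib_left sum_distrib_left ac_simps)
  finally have W: "norm (W (Suc k)) \<le> sqrt (8 * D) * N" .
  have iter: "dual_iterate A x k - p = (1 / S (Suc k)) *\<^sub>R W (Suc k)"
    unfolding W_def by (rule dual_iterate_minus[OF k])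
  have Sp: "0 < S (Suc k)"
    by (rule S_pos[OF k])
  have "(norm (dual_iterate A x k - p))\<^sup>2 = (norm (W (Suc k)))\<^sup>2 / (S (Suc k))\<^sup>2"
    using Sp by (simp add: iter power_divide)
  also have "\<dots> \<le> (sqrt (8 * D) * N)\<^sup>2 / (S (Suc k))\<^sup>2"
    using W by (intro divide_right_mono power_mono) auto
  also have "\<dots> = B_coeff A k * D"
    using D0 unfolding B_coeff_def sum_from_1 N_def by (simp add: power_mult_distrib power_divide)
  finally show "(norm (dual_iterate A x k - p))\<^sup>2 \<le> B_coeff A k * D" .
  \<comment> \<open>Here the square is discarded instead of the pairing.\<close>
  have "p \<bullet> W (Suc k) \<le> 4 * A (Suc k) * D"
    using pot[of "Suc k"] zero_le_power2[of "norm (G (Suc k))"] by linarith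
  then have "p \<bullet> W (Suc k) / S (Suc k) \<le> 4 * A (Suc k) * D / S (Suc k)"
    using Sp by (intro divide_right_mono) auto
  then show "p \<bullet> (dual_iterate A x k - p) \<le> C_coeff A k * D"
    unfolding iter C_coeff_def sum_from_1 by simp
qed

end

section \<open>Asymptotics of the coefficients\<close>

text \<open>The Theta condition is only eventual; positivity of the finitely many earlier increments
  makes it uniform. \<open>Suc k\<close> replaces \<open>k\<close> so that the upper bound can hold
  at \<open>0\<close>.\<close>

lemma linear_growth_bounds:
  assumes "step_size_condition L A"
  obtains c C where "0 < c" "0 < C"
    "\<And>k. c * real (Suc k) \<le> fwd_diff A k" "\<And>k. fwd_diff A k \<le> C * real (Suc k)"
proof -
  have pos: "0 < fwd_diff A k" for k
    using assms by (simp add: step_size_condition_def)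
  have th: "fwd_diff A \<in> \<Theta>(\<lambda>k. real k)"
    using assms by (simp add: step_size_condition_def)
  obtain C1 where C1: "C1 > 0" "\<forall>\<^sub>F k in at_top. norm (fwd_diff A k) \<le> C1 * norm (real k)"
    using landau_o.bigE[OF bigthetaD1[OF th]] by blast
  obtain c1 where c1: "c1 > 0" "\<forall>\<^sub>F k in at_top. norm (fwd_diff A k) \<ge> c1 * norm (real k)"
    using landau_omega.bigE[OF bigthetaD2[OF th]] by blast
  obtain N where N: "\<And>k. k \<ge> N \<Longrightarrow> fwd_diff A k \<le> C1 * real k"
      "\<And>k. k \<ge> N \<Longrightarrow> c1 * real k \<le> fwd_diff A k"
    using eventually_conj[OF C1(2) c1(2)] pos unfolding eventually_at_top_linorder
    by (auto simp: less_imp_le abs_of_pos)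
  define r where "r k = fwd_diff A k / real (Suc k)" for k
  \<comment> \<open>Halving \<open>c1\<close> pays for \<open>real (Suc k) \<le> 2 * real k\<close>
    beyond \<open>N\<close>.\<close>
  define c where "c = Min (insert (c1 / 2) (r ` {..N}))"
  define C where "C = Max (insert C1 (r ` {..N}))"
  have rpos: "0 < r k" for k
    using pos by (simp add: r_def)
  have "0 < c"
    unfolding c_def using rpos c1(1) by (subst Min_gr_iff) auto
  moreover have "0 < C"
    unfolding C_def using C1(1) by (subst Max_gr_iff) auto
  moreover have "c * real (Suc k) \<le> fwd_diff A k" for k
  proof (cases "k \<le> N")
    case True
    then have "c \<le> r k"
      unfolding c_def by (intro Min_le) auto
    then show ?thesis
      by (simp add: r_def field_simps)
  next
    case False
    have "c \<le> c1 / 2"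
      unfolding c_def by (intro Min_le) auto
    then have "c * real (Suc k) \<le> c1 / 2 * real (Suc k)"
      by (intro mult_right_mono) auto
    also have "\<dots> = c1 * (real (Suc k) / 2)"
      by simp
    also have "\<dots> \<le> c1 * real k"
      using c1(1) False by (intro mult_left_mono) auto
    finally show ?thesis
      using N(2)[of k] False by simp
  qed
  moreover have "fwd_diff A k \<le> C * real (Suc k)" for k
  proof (cases "k \<le> N")
    case True
    then have "r k \<le> C"
      unfolding C_def by (intro Max_ge) auto
    then show ?thesis
      by (simp add: r_def field_simps)
  next
    case False
    have "C1 \<le> C"
      unfolding C_def by (intro Max_ge) auto
    then have "C1 * real k \<le> C * real (Suc k)"
      using C1(1) by (intro mult_mono) auto
    then show ?thesis
      using N(1)[of k] False by simp
  qed
  ultimately show ?thesis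
    by (rule that)
qed

text \<open>Discrete analogue of integrating a cube; it yields the quartic growth of the common
  denominator.\<close>

lemma sum_cubes_ge: "(real k)^4 / 4 \<le> (\<Sum>i=1..k. (real i)^3)"
proof (induction k)
  case (Suc k)
  have "(real (Suc k))^4 / 4 \<le> (real k)^4 / 4 + (real (Suc k))^3"
    by (simp add: power4_eq_xxxx power3_eq_cube algebra_simps)
  with Suc show ?case by simp
qed simp

text \<open>Increments are linear and \<open>A\<close> quadratic, so the denominator is at least of
  order \<open>k^4\<close>, the numerator inside \<open>B_coeff\<close> at most cubic, and that of
  \<open>C_coeff\<close> quadratic.\<close>

lemma coefficients_bigo:
  assumes steps: "step_size_condition L A"
  shows "B_coeff A \<in> O(\<lambda>k. 1 / (real k)\<^sup>2)" and "C_coeff A \<in> O(\<lambda>k. 1 / (real k)\<^sup>2)"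
proof -
  obtain c C where c: "0 < c" and C: "0 < C"
    and lo: "\<And>k. c * real (Suc k) \<le> fwd_diff A k"
    and hi: "\<And>k. fwd_diff A k \<le> C * real (Suc k)"
    using linear_growth_bounds[OF steps] by metis
  have A0: "A 0 = 0"
    using steps by (simp add: step_size_condition_def)
  have A_Suc: "A (Suc k) = A k + fwd_diff A k" for k
    by (simp add: fwd_diff_def)
  have A_lo: "c / 2 * (real k)\<^sup>2 \<le> A k" for k
  proof (induction k)
    case (Suc k)
    have "c / 2 * (real (Suc k))\<^sup>2 \<le> c / 2 * (real k)\<^sup>2 + c * real (Suc k)"
      using c by (simp add: power2_eq_square algebra_simps)
    with Suc lo[of k] show ?case
      unfolding A_Suc by linarith
  qed (simp add: A0)
  have A_hi: "A k \<le> C * (real k)\<^sup>2" for k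
  proof (induction k)
    case (Suc k)
    have "C * (real k)\<^sup>2 + C * real (Suc k) \<le> C * (real (Suc k))\<^sup>2"
      using C by (simp add: power2_eq_square algebra_simps)
    with Suc hi[of k] show ?case
      unfolding A_Suc by linarith
  qed (simp add: A0)
  have A_nonneg: "0 \<le> A k" for k
    using A_lo[of k] c by (smt (verit) divide_nonneg_nonneg mult_nonneg_nonneg zero_le_power2)
  have a_nonneg: "0 \<le> fwd_diff A k" for k
    using lo[of k] c by (smt (verit) mult_nonneg_nonneg of_nat_0_le_iff)
  have sqrt_A: "sqrt (A k) \<le> sqrt C * real k" for k
    using real_sqrt_le_mono[OF A_hi[of k]] by (simp add: real_sqrt_mult)
  define T where "T k = (\<Sum>i=1..k. A i * fwd_diff A i)" for k
  have T: "c\<^sup>2 / 8 * (real k)^4 \<le> T k" for k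
  proof -
    have "c\<^sup>2 / 8 * (real k)^4 = c\<^sup>2 / 2 * ((real k)^4 / 4)"
      by simp
    also have "\<dots> \<le> c\<^sup>2 / 2 * (\<Sum>i=1..k. (real i)^3)"
      by (intro mult_left_mono sum_cubes_ge) simp
    also have "\<dots> = (\<Sum>i=1..k. (c / 2 * (real i)\<^sup>2) * (c * real i))"
      by (simp add: sum_distrib_left power2_eq_square power3_eq_cube mult_ac)
    also have "\<dots> \<le> T k"
      unfolding T_def
    proof (intro sum_mono mult_mono)
      show "c * real i \<le> fwd_diff A i" for i
        using lo[of i] c by (simp add: algebra_simps)
    qed (use A_lo A_nonneg c in auto)
    finally show ?thesis .
  qed
  have T_pos: "0 < c\<^sup>2 / 8 * (real k)^4" if "k \<ge> 1" for k
    using that c by simp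
  define N where "N k = A k * sqrt (A (k + 1)) + (\<Sum>i=1..k. sqrt (A i) * fwd_diff A (i - 1))" for k
  have N_nonneg: "0 \<le> N k" for k
    unfolding N_def using A_nonneg a_nonneg by (intro add_nonneg_nonneg mult_nonneg_nonneg sum_nonneg) auto
  have N_le: "N k \<le> 3 * C * sqrt C * (real k)^3" if k: "k \<ge> 1" for k
  proof -
    \<comment> \<open>The factor \<open>3\<close> is \<open>2\<close> from
      \<open>k + 1 \<le> 2 * k\<close> plus \<open>1\<close> from a sum of \<open>k\<close> terms,
      each at most quadratic.\<close>
    have "A k * sqrt (A (k + 1)) \<le> (C * (real k)\<^sup>2) * (sqrt C * real (k + 1))"
      using A_hi[of k] sqrt_A[of "k + 1"] A_nonneg C by (intro mult_mono) auto
    also have "\<dots> \<le> (C * (real k)\<^sup>2) * (sqrt C * (2 * real k))"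
      using k C by (intro mult_left_mono) auto
    finally have 1: "A k * sqrt (A (k + 1)) \<le> 2 * C * sqrt C * (real k)^3"
      by (simp add: power2_eq_square power3_eq_cube mult_ac)
    have "(\<Sum>i=1..k. sqrt (A i) * fwd_diff A (i - 1)) \<le> (\<Sum>i=1..k. (sqrt C * real k) * (C * real k))"
    proof (intro sum_mono mult_mono)
      fix i assume i: "i \<in> {1..k}"
      have "sqrt C * real i \<le> sqrt C * real k"
        using i C by (intro mult_left_mono) auto
      then show "sqrt (A i) \<le> sqrt C * real k"
        using sqrt_A[of i] by linarith
      have "C * real i \<le> C * real k"
        using i C by (intro mult_left_mono) auto
      then show "fwd_diff A (i - 1) \<le> C * real k"
        using hi[of "i - 1"] i by simp
    qed (use C A_nonneg a_nonneg in auto)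
    also have "\<dots> = C * sqrt C * (real k)^3"
      by (simp add: power3_eq_cube mult_ac)
    finally show ?thesis
      using 1 by (simp add: N_def)
  qed
  define K where "K = 3 * C * sqrt C / (c\<^sup>2 / 8)"
  have B: "norm (B_coeff A k) \<le> 8 * K\<^sup>2 * norm (1 / (real k)\<^sup>2)" if k: "k \<ge> 1" for k
  proof -
    have T0: "0 < T k"
      using T[of k] T_pos[OF k] by linarith
    have "N k / T k \<le> (3 * C * sqrt C * (real k)^3) / (c\<^sup>2 / 8 * (real k)^4)"
      using N_le[OF k] N_nonneg[of k] T[of k] T_pos[OF k] by (intro frac_le) auto
    also have "\<dots> = K / real k"
      using k by (simp add: K_def power3_eq_cube power4_eq_xxxx)
    finally have "(N k / T k)\<^sup>2 \<le> (K / real k)\<^sup>2"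
      using N_nonneg[of k] T0 by (intro power_mono) auto
    then show ?thesis
      by (simp add: B_coeff_def N_def T_def power_divide)
  qed
  then show "B_coeff A \<in> O(\<lambda>k. 1 / (real k)\<^sup>2)"
    by (intro bigoI[of _ "8 * K\<^sup>2"] eventually_at_top_linorderI[of 1]) auto
  \<comment> \<open>The \<open>16\<close> is the \<open>4\<close> of \<open>C_coeff\<close> times
    the square of the \<open>2\<close> in \<open>k + 1 \<le> 2 * k\<close>.\<close>
  define K' where "K' = 16 * C / (c\<^sup>2 / 8)"
  have "norm (C_coeff A k) \<le> K' * norm (1 / (real k)\<^sup>2)" if k: "k \<ge> 1" for k
  proof -
    have T0: "0 < T k"
      using T[of k] T_pos[OF k] by linarith
    have "(real (k + 1))\<^sup>2 \<le> (2 * real k)\<^sup>2"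
      using k by (intro power_mono) auto
    then have "C * (real (k + 1))\<^sup>2 \<le> C * (2 * real k)\<^sup>2"
      using C by (intro mult_left_mono) auto
    then have "4 * A (k + 1) \<le> 16 * C * (real k)\<^sup>2"
      using A_hi[of "k + 1"] by (simp add: power_mult_distrib)
    then have "4 * A (k + 1) / T k \<le> (16 * C * (real k)\<^sup>2) / (c\<^sup>2 / 8 * (real k)^4)"
      using A_nonneg[of "k + 1"] T[of k] T_pos[OF k] by (intro frac_le) auto
    also have "\<dots> = K' / (real k)\<^sup>2"
      using k by (simp add: K'_def power2_eq_square power4_eq_xxxx)
    finally show ?thesis
      using A_nonneg[of "k + 1"] T0 by (simp add: C_coeff_def T_def)
  qed
  then show "C_coeff A \<in> O(\<lambda>k. 1 / (real k)\<^sup>2)"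
    by (intro bigoI[of _ K'] eventually_at_top_linorderI[of 1]) auto
qed

section \<open>Reduction of the extended-real statement to the real estimates\<close>

theorem theorem5p4:
  fixes f :: "real^'n \<Rightarrow> real"
    and L :: real
    and A :: "nat \<Rightarrow> real"
    and x0 :: "real^'n"
    and x y :: "nat \<Rightarrow> real^'n"
  assumes "L > 0"
    and "f \<in> smooth_convex L"
    and "step_size_condition L A"
    and "agm_trajectory f A x0 x y"
  shows "(\<forall>k\<ge>1. dual_iterate A x k \<in> conjugate_dom f) \<and>
    (\<forall>pstar. is_arg_min norm (\<lambda>p. p \<in> conjugate_dom f) pstar \<longrightarrow>
       (\<forall>k\<ge>1. ereal ((norm (dual_iterate A x k - pstar))\<^sup>2)
                \<le> ereal (B_coeff A k) * dual_divergence f x0 pstar) \<and>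
       (\<lambda>k. B_coeff A k * real_of_ereal (dual_divergence f x0 pstar))
          \<in> O(\<lambda>k. 1 / (real k)\<^sup>2) \<and>
       (pstar \<noteq> 0 \<longrightarrow>
          (\<forall>k\<ge>1. ereal ((norm (dual_iterate A x k))\<^sup>2 - (norm pstar)\<^sup>2)
                   \<le> ereal (C'_coeff A k) * dual_divergence f x0 pstar
                     + ereal ((C_coeff A k)\<^sup>2) * (dual_divergence f x0 pstar)\<^sup>2
                       / ereal ((norm pstar)\<^sup>2)) \<and>
          (\<lambda>k. C'_coeff A k * real_of_ereal (dual_divergence f x0 pstar)
                + (C_coeff A k)\<^sup>2 * (real_of_ereal (dual_divergence f x0 pstar))\<^sup>2
                  / (norm pstar)\<^sup>2)
             \<in> O(\<lambda>k. 1 / (real k)\<^sup>2)))"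
proof -
  interpret accelerated_gradient f L A x0 x y
    using assms by unfold_locales
  have BC: "B_coeff A \<in> O(\<lambda>k. 1 / (real k)\<^sup>2)" "C_coeff A \<in> O(\<lambda>k. 1 / (real k)\<^sup>2)"
    using coefficients_bigo[OF steps] .
  show ?thesis
  proof (intro conjI allI impI)
    show "dual_iterate A x k \<in> conjugate_dom f" if "1 \<le> k" for k
      using that by (rule dual_iterate_in_conjugate_dom)
  next
    fix p
    assume min: "is_arg_min norm (\<lambda>p. p \<in> conjugate_dom f) p"
    then have "p \<in> conjugate_dom f"
      by (simp add: is_arg_min_def)
    then obtain M where fp: "fenchel_conjugate f p = ereal M" and M: "\<And>u. p \<bullet> u - f u \<le> M"
      by (rule conjugate_domE) blast
    \<comment> \<open>With \<open>M\<close> the exact conjugate value, \<open>D\<close> is the real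
      number behind the dual divergence.\<close>
    define D where "D = f x0 + M - p \<bullet> x0"
    have div: "dual_divergence f x0 p = ereal D"
      by (simp add: dual_divergence_def fp D_def)
    have p: "p \<bullet> p \<le> p \<bullet> gradient f u" for u
      using min_norm_point_inner[OF convex_conjugate_dom min] gradient_in_conjugate_dom[OF f] by blast
    note bounds = dual_bounds[OF p M D_def]
    show "ereal ((norm (dual_iterate A x k - p))\<^sup>2) \<le> ereal (B_coeff A k) * dual_divergence f x0 p"
      if "1 \<le> k" for k
      using bounds(1)[OF that] by (simp add: div)
    show "(\<lambda>k. B_coeff A k * real_of_ereal (dual_divergence f x0 p)) \<in> O(\<lambda>k. 1 / (real k)\<^sup>2)"
      using landau_o.big_1_mult[OF BC(1), of "\<lambda>_. D"] by (simp add: div)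
    assume "p \<noteq> 0"
    show "ereal ((norm (dual_iterate A x k))\<^sup>2 - (norm p)\<^sup>2)
       \<le> ereal (C'_coeff A k) * dual_divergence f x0 p
         + ereal ((C_coeff A k)\<^sup>2) * (dual_divergence f x0 p)\<^sup>2 / ereal ((norm p)\<^sup>2)"
      if k: "1 \<le> k" for k
    proof -
      \<comment> \<open>Expanding around \<open>p\<close> gives the squared distance plus twice the
        pairing, hence \<open>B_coeff + 2 * C_coeff\<close>.\<close>
      have "(norm (dual_iterate A x k))\<^sup>2 - (norm p)\<^sup>2
          = (norm (dual_iterate A x k - p))\<^sup>2 + 2 * (p \<bullet> (dual_iterate A x k - p))"
        by (simp add: power2_norm_eq_inner inner_diff_left inner_diff_right inner_commute)
      also have "\<dots> \<le> C'_coeff A k * D"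
        using bounds[OF k] by (simp add: C'_coeff_def algebra_simps)
      also have "\<dots> \<le> C'_coeff A k * D + (C_coeff A k)\<^sup>2 * D\<^sup>2 / (norm p)\<^sup>2"
        by simp
      finally show ?thesis
        using \<open>p \<noteq> 0\<close> by (simp add: div)
    qed
    \<comment> \<open>One factor of the squared coefficient is treated as bounded, so the other
      supplies the rate.\<close>
    have "(\<lambda>k. 1 / (real k)\<^sup>2) \<in> O(\<lambda>_. 1)"
      by (intro bigoI[of _ 1] eventually_at_top_linorderI[of 1]) (auto simp: field_simps)
    then have "C_coeff A \<in> O(\<lambda>_. 1)"
      by (rule landau_o.big_trans[OF BC(2)])
    then have "(\<lambda>k. C_coeff A k * C_coeff A k) \<in> O(\<lambda>k. 1 / (real k)\<^sup>2)"
      by (rule landau_o.big_1_mult[OF BC(2)])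
    then have quad: "(\<lambda>k. C_coeff A k * C_coeff A k * (D\<^sup>2 / (norm p)\<^sup>2)) \<in> O(\<lambda>k. 1 / (real k)\<^sup>2)"
      by (rule landau_o.big_1_mult) simp
    have "(\<lambda>k. B_coeff A k + 2 * C_coeff A k) \<in> O(\<lambda>k. 1 / (real k)\<^sup>2)"
      using BC by (intro sum_in_bigo) auto
    then have lin: "(\<lambda>k. (B_coeff A k + 2 * C_coeff A k) * D) \<in> O(\<lambda>k. 1 / (real k)\<^sup>2)"
      by (rule landau_o.big_1_mult) simp
    have eq: "(\<lambda>k. C'_coeff A k * real_of_ereal (dual_divergence f x0 p)
          + (C_coeff A k)\<^sup>2 * (real_of_ereal (dual_divergence f x0 p))\<^sup>2 / (norm p)\<^sup>2)
        = (\<lambda>k. (B_coeff A k + 2 * C_coeff A k) * D + C_coeff A k * C_coeff A k * (D\<^sup>2 / (norm p)\<^sup>2))"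
      by (simp add: div C'_coeff_def power2_eq_square)
    show "(\<lambda>k. C'_coeff A k * real_of_ereal (dual_divergence f x0 p)
          + (C_coeff A k)\<^sup>2 * (real_of_ereal (dual_divergence f x0 p))\<^sup>2 / (norm p)\<^sup>2)
        \<in> O(\<lambda>k. 1 / (real k)\<^sup>2)"
      unfolding eq by (rule sum_in_bigo(1)[OF lin quad])
  qed
qed

end
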